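(* Let $\mathfrak{X},\mathfrak{Y},\mathfrak{Z}$ be linear spaces over $\mathbb{K}$ and let $A\subseteq\mathfrak{X}\times\mathfrak{Z}$ and $B\subseteq\mathfrak{X}\times\mathfrak{Y}$ be two linear relations. The following statements are equivalent: (i) There exists an operator $C$ between $\mathfrak{Y}$ and $\mathfrak{Z}$ such that $A\subseteq CB$. (ii) There exist a Hamel basis $\{z_\alpha\}_{\alpha\in I}$ for $\mathrm{ran}\,A$, a linearly independent family $\{y_\alpha\}_{\alpha\in I}$ such that $y_\alpha\in BA^{-1}(z_\alpha)$ for all $\alpha\in I$, a Hamel basis $\{x'_\beta\}_{\beta\in J}$ for $\ker A$, and a family $\{y'_\beta\}_{\beta\in J}$ such that $y'_\beta\in B(x'_\beta)$ for all $\beta\in J$, and $$\mathrm{Sp}\{y_\alpha\}_{\alpha\in I}\cap\mathrm{Sp}\{y'_\beta\}_{\beta\in J}=\{0\}.$$ (iii) For every Hamel basis $\{z_\alpha\}_{\alpha\in I}$ for $\mathrm{ran}\,A$ there exists a linearly independent family $\{y_\alpha\}_{\alpha\in I}$ such that $y_\alpha\in BA^{-1}(z_\alpha)$ for all $\alpha\in I$, and for every Hamel basis $\{x'_\beta\}_{\beta\in J}$ for $\ker A$ there exists a family $\{y'_\beta\}_{\beta\in J}$ such that $y'_\beta\in B(x'_\beta)$ for all $\beta\in J$ and $$\mathrm{Sp}\{y_\alpha\}_{\alpha\in I}\cap\mathrm{Sp}\{y'_\beta\}_{\beta\in J}=\{0\}.$$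
   Context: $\mathbb{K}$ is $\mathbb{R}$ or $\mathbb{C}$. A linear relation between linear spaces $\mathfrak{X}$ and $\mathfrak{Y}$ is a linear subspace $R$ of $\mathfrak{X}\times\mathfrak{Y}$. Its inverse is $R^{-1}=\{(y,x):(x,y)\in R\}$. For $x\in\mathfrak{X}$, $R(x)=\{y:(x,y)\in R\}$. Put $\mathrm{ran}\,R=\{y:(x,y)\in R\text{ for some }x\}$, $\ker R=\{x:(x,0)\in R\}$, $\mathrm{mul}\,R=R(0)$. For linear relations $R\subseteq\mathfrak{X}\times\mathfrak{Y}$ and $S\subseteq\mathfrak{Y}\times\mathfrak{Z}$ the product is $SR=\{(x,z):(x,y)\in R\text{ and }(y,z)\in S\text{ for some }y\in\mathfrak{Y}\}$. An operator between $\mathfrak{X}$ and $\mathfrak{Y}$ is a linear map defined on a linear subspace of $\mathfrak{X}$ (not necessarily all of $\mathfrak{X}$) with values in $\mathfrak{Y}$; it is identified with its graph, i.e. with a linear relation $R$ with $\mathrm{mul}\,R=\{0\}$. $\mathrm{Sp}$ denotes linear span. By convention, $\{0\}$ is considered as the only linearly independent system (Hamel basis) of the null space.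
   Formalization: The convention on {0} is made precise for the family y: the one-element family y = 0 counts as linearly independent exactly when ran A = {0}. Read literally it fails, e.g. for Y = {0}, A the identity on K, B = K × {0}, where (ii) and (iii) hold but (i) does not. *)

theory Defs
  imports "HOL-Analysis.Product_Vector"
begin

text \<open>
  The scalar field is a type of class \<^class>\<open>real_normed_field\<close>. The norm of this class is
  multiplicative, so by the theorems of Ostrowski and Gelfand--Mazur its instances are exactly the
  fields isomorphic to the real or to the complex numbers. A linear space is a type together with
  a scalar multiplication satisfying \<^const>\<open>vector_space\<close>.
\<close>

definition linear_relation ::
  "('k::real_normed_field \<Rightarrow> 'a::ab_group_add \<Rightarrow> 'a) \<Rightarrow> ('k \<Rightarrow> 'b::ab_group_add \<Rightarrow> 'b) \<Rightarrow> ('a \<times> 'b) set \<Rightarrow> bool"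
  where "linear_relation s1 s2 R \<longleftrightarrow> module.subspace (module_prod.scale s1 s2) R"

definition rel_ker :: "('a \<times> 'b::zero) set \<Rightarrow> 'a set"
  where "rel_ker R = {x. (x, 0) \<in> R}"

definition rel_mul :: "('a::zero \<times> 'b) set \<Rightarrow> 'b set"
  where "rel_mul R = R `` {0}"

text \<open>Operators need not be everywhere defined; they are identified with their graphs.\<close>

definition is_operator ::
  "('k::real_normed_field \<Rightarrow> 'a::ab_group_add \<Rightarrow> 'a) \<Rightarrow> ('k \<Rightarrow> 'b::ab_group_add \<Rightarrow> 'b) \<Rightarrow> ('a \<times> 'b) set \<Rightarrow> bool"
  where "is_operator s1 s2 R \<longleftrightarrow> linear_relation s1 s2 R \<and> rel_mul R = {0}"

text \<open>
  The product \<open>S R\<close> (first \<open>R\<close>, then \<open>S\<close>) is \<^term>\<open>R O S\<close> in the order of \<^const>\<open>relcomp\<close>,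
  and \<open>R(x)\<close> is \<^term>\<open>R `` {x}\<close>.
\<close>

definition relation_product :: "('b \<times> 'c) set \<Rightarrow> ('a \<times> 'b) set \<Rightarrow> ('a \<times> 'c) set"
  where "relation_product S R = R O S"

text \<open>
  Linear independence of an indexed family: the vectors are pairwise distinct and form an
  independent set. The empty family is excluded, because of the convention that \<open>{0}\<close> is the only
  linearly independent system of the null space.
\<close>

definition lin_indep_family ::
  "('k::real_normed_field \<Rightarrow> 'v::ab_group_add \<Rightarrow> 'v) \<Rightarrow> 'i set \<Rightarrow> ('i \<Rightarrow> 'v) \<Rightarrow> bool"
  where "lin_indep_family s I f \<longleftrightarrow>
    I \<noteq> {} \<and> inj_on f I \<and> \<not> module.dependent s (f ` I)"

definition zero_system :: "'i set \<Rightarrow> ('i \<Rightarrow> 'v::zero) \<Rightarrow> bool"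
  where "zero_system I f \<longleftrightarrow> (\<exists>i. I = {i} \<and> f i = 0)"

text \<open>
  Linear independence, with the convention for the null space, of a family whose index set is that
  of a Hamel basis of \<open>W\<close>. The family itself may lie in another space. The one-element family
  \<open>{0}\<close> is admitted only if \<open>W\<close> is the null space: if it were admitted for every one-element index
  set, then \<open>{0}\<close> would be a linearly independent family matching a basis of a one-dimensional \<open>W\<close>.
\<close>

definition lin_indep_system ::
  "('k::real_normed_field \<Rightarrow> 'v::ab_group_add \<Rightarrow> 'v) \<Rightarrow> 'w::zero set \<Rightarrow> 'i set \<Rightarrow> ('i \<Rightarrow> 'v) \<Rightarrow> bool"
  where "lin_indep_system s W I f \<longleftrightarrow>
    lin_indep_family s I f \<or> (W = {0} \<and> zero_system I f)"

definition hamel_basis ::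
  "('k::real_normed_field \<Rightarrow> 'v::ab_group_add \<Rightarrow> 'v) \<Rightarrow> 'v set \<Rightarrow> 'i set \<Rightarrow> ('i \<Rightarrow> 'v) \<Rightarrow> bool"
  where "hamel_basis s W I f \<longleftrightarrow>
    lin_indep_system s W I f \<and> module.span s (f ` I) = W"

end

theory Submission
  imports Defs
begin

text \<open>
  For (i) \<open>\<Longrightarrow>\<close> (iii), lift the two Hamel bases through \<open>C\<close>: choose \<open>y \<alpha>\<close> with \<open>(y \<alpha>, z \<alpha>) \<in> C\<close> and
  \<open>y' \<beta>\<close> with \<open>(y' \<beta>, 0) \<in> C\<close>. Since \<open>C\<close> is single-valued, independence of the \<open>z \<alpha>\<close> passes to
  the \<open>y \<alpha>\<close>, and the span of the \<open>y \<alpha>\<close> meets the kernel of \<open>C\<close> only in \<open>0\<close>.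
  For (ii) \<open>\<Longrightarrow>\<close> (i), take a linear \<open>g\<close> with \<open>g (y \<alpha>) = z \<alpha>\<close> and let \<open>C\<close> send \<open>u + v\<close> to \<open>g u\<close> for
  \<open>u\<close> in the span of the \<open>y \<alpha>\<close> and \<open>v\<close> in the span of the \<open>y' \<beta>\<close>.
\<close>

section \<open>Closure properties of linear relations and single-valuedness of operators\<close>

lemma linear_relation_iff:
  assumes "vector_space s1" and "vector_space s2"
  shows "linear_relation s1 s2 R \<longleftrightarrow>
    (0, 0) \<in> R \<and>
    (\<forall>x y x' y'. (x, y) \<in> R \<longrightarrow> (x', y') \<in> R \<longrightarrow> (x + x', y + y') \<in> R) \<and>
    (\<forall>c x y. (x, y) \<in> R \<longrightarrow> (s1 c x, s2 c y) \<in> R)"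
proof -
  interpret v1: vector_space s1 by fact
  interpret v2: vector_space s2 by fact
  interpret p: module_prod s1 s2 ..
  show ?thesis
    unfolding linear_relation_def p.p.subspace_def p.scale_def
    by (simp add: zero_prod_def split_paired_Ball_Sigma Ball_def)
qed

lemma linear_relation_diff:
  assumes "vector_space s1" and "vector_space s2" and R: "linear_relation s1 s2 R"
    and "(x, y) \<in> R" and "(x', y') \<in> R"
  shows "(x - x', y - y') \<in> R"
proof -
  interpret v1: vector_space s1 by fact
  interpret v2: vector_space s2 by fact
  note R' = R[unfolded linear_relation_iff[OF assms(1,2)]]
  have "(s1 (- 1) x', s2 (- 1) y') \<in> R"
    using R' \<open>(x', y') \<in> R\<close> by blast
  then have "(x + s1 (- 1) x', y + s2 (- 1) y') \<in> R"
    using R' \<open>(x, y) \<in> R\<close> by blast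
  then show ?thesis by simp
qed

text \<open>Kernels and ranges are special cases (\<open>W\<close> the zero space; the converse
  relation with \<open>W\<close> the whole space). With \<open>W\<close> a span or a summand, the
  lemma reduces inclusions of spans to a check on generators.\<close>

lemma subspace_preimage:
  assumes "vector_space s1" and "vector_space s2" and R: "linear_relation s1 s2 R"
    and W: "module.subspace s2 W"
  shows "module.subspace s1 {x. \<exists>y\<in>W. (x, y) \<in> R}"
proof -
  interpret v1: vector_space s1 by fact
  interpret v2: vector_space s2 by fact
  note R' = R[unfolded linear_relation_iff[OF assms(1,2)]]
  show ?thesis
  proof (rule v1.subspaceI; clarsimp)
    show "\<exists>y\<in>W. (0, y) \<in> R" using R' W v2.subspace_0 by blast
  next
    fix x y x' y' assume "y \<in> W" "(x, y) \<in> R" "y' \<in> W" "(x', y') \<in> R"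
    then have "y + y' \<in> W" "(x + x', y + y') \<in> R" using R' W v2.subspace_add by blast+
    then show "\<exists>y\<in>W. (x + x', y) \<in> R" by blast
  next
    fix c x y assume "y \<in> W" "(x, y) \<in> R"
    then have "s2 c y \<in> W" "(s1 c x, s2 c y) \<in> R" using R' W v2.subspace_scale by blast+
    then show "\<exists>y\<in>W. (s1 c x, y) \<in> R" by blast
  qed
qed

lemma subspace_rel_ker:
  assumes "vector_space s1" and "vector_space s2" and R: "linear_relation s1 s2 R"
  shows "module.subspace s1 (rel_ker R)"
proof -
  interpret v2: vector_space s2 by fact
  have "rel_ker R = {x. \<exists>y\<in>{0}. (x, y) \<in> R}" by (simp add: rel_ker_def)
  then show ?thesis
    using subspace_preimage[OF assms v2.subspace_single_0] by simp
qed

lemma subspace_Range: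
  assumes "vector_space s1" and "vector_space s2" and R: "linear_relation s1 s2 R"
  shows "module.subspace s2 (Range R)"
proof -
  interpret v1: vector_space s1 by fact
  interpret v2: vector_space s2 by fact
  have "linear_relation s2 s1 (R\<inverse>)"
    using R by (simp add: linear_relation_iff assms(1,2))
  from subspace_preimage[OF assms(2,1) this v1.subspace_UNIV] have "v2.subspace {y. \<exists>x. (x, y) \<in> R}"
    by simp
  also have "{y. \<exists>x. (x, y) \<in> R} = Range R" by auto
  finally show ?thesis .
qed

text \<open>Subtracting the two pairs leaves \<open>(0, w - w')\<close>, so the difference of the
  values lies in the multivalued part, which is zero.\<close>

lemma operator_unique:
  assumes "vector_space s1" and "vector_space s2" and C: "is_operator s1 s2 C"
    and "(u, w) \<in> C" and "(u, w') \<in> C"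
  shows "w = w'"
proof -
  have "(u - u, w - w') \<in> C"
    using assms linear_relation_diff unfolding is_operator_def by metis
  then have "w - w' \<in> rel_mul C" by (simp add: rel_mul_def)
  then show ?thesis
    using C by (simp add: is_operator_def)
qed

section \<open>Hamel bases and linear extension under the null space convention\<close>

lemma hamel_basis_exists:
  fixes s :: "'k::real_normed_field \<Rightarrow> 'v::ab_group_add \<Rightarrow> 'v"
  assumes "vector_space s" and W: "module.subspace s W"
  shows "\<exists>(I :: 'v set) f. hamel_basis s W I f"
proof -
  interpret v: vector_space s by fact
  obtain S where S: "S \<subseteq> W" "v.independent S" "W \<subseteq> v.span S"
    by (metis v.basis_exists)
  have sp: "v.span S = W"
    using S W by (metis v.span_minimal subset_antisym)
  show ?thesis
  proof (cases "S = {}")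
    case True
    \<comment> \<open>The null space has the empty set as its usual basis; the convention replaces
      it by the one-element family \<open>0\<close>.\<close>
    then have "hamel_basis s W {0} (\<lambda>x. x)"
      using sp v.span_zero unfolding hamel_basis_def lin_indep_system_def zero_system_def
      by (auto simp: v.span_insert_0)
    then show ?thesis by blast
  next
    case False
    then have "hamel_basis s W S (\<lambda>x. x)"
      using sp S unfolding hamel_basis_def lin_indep_system_def lin_indep_family_def by simp
    then show ?thesis by blast
  qed
qed

text \<open>A genuinely independent family can be sent anywhere by a linear map. The zero system can
  only be sent to zero, so for the null space \<open>h\<close> has to vanish, and the zero map
  serves.\<close>

lemma lin_indep_system_extend:
  assumes "vector_space s1" and "vector_space s2"
    and f: "lin_indep_system s1 W I f"
    and h: "W = {0} \<Longrightarrow> \<forall>i\<in>I. h i = 0"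
  shows "\<exists>g. Vector_Spaces.linear s1 s2 g \<and> (\<forall>i\<in>I. g (f i) = h i)"
proof -
  interpret vector_space_pair s1 s2
    using assms(1,2) by (simp add: vector_space_pair_def)
  show ?thesis
  proof (cases "W = {0}")
    case True
    have "Vector_Spaces.linear s1 s2 (\<lambda>x. 0)" by (rule module_hom_zero)
    then show ?thesis using h True by force
  next
    case False
    then have inj: "inj_on f I" and ind: "vs1.independent (f ` I)"
      using f by (auto simp: lin_indep_system_def lin_indep_family_def)
    \<comment> \<open>Values prescribed on indices become values prescribed on vectors by inverting
      the injective family \<open>f\<close>.\<close>
    obtain g where "Vector_Spaces.linear s1 s2 g"
      and "\<forall>x\<in>f ` I. g x = (h \<circ> the_inv_into I f) x"
      using linear_independent_extend[OF ind] by blast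
    then show ?thesis
      using inj by (auto simp: the_inv_into_f_f)
  qed
qed

section \<open>Lifting bases through an operator\<close>

lemma lin_indep_family_lift:
  assumes "vector_space s1" and "vector_space s2"
    and C: "is_operator s1 s2 C"
    and h: "lin_indep_family s2 I h"
    and fh: "\<And>i. i \<in> I \<Longrightarrow> (f i, h i) \<in> C"
  shows "lin_indep_family s1 I f"
proof -
  interpret v1: vector_space s1 by fact
  interpret v2: vector_space s2 by fact
  have lin: "linear_relation s1 s2 C"
    using C by (simp add: is_operator_def)
  note unique = operator_unique[OF assms(1,2) C]
  have inj: "inj_on h I" and ind: "v2.independent (h ` I)" and "I \<noteq> {}"
    using h by (auto simp: lin_indep_family_def)
  have "inj_on f I"
    using inj fh unique by (metis inj_on_def)
  moreover have "v1.independent (f ` I)"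
  proof
    assume "v1.dependent (f ` I)"
    then obtain a where a: "a \<in> I" "f a \<in> v1.span (f ` I - {f a})"
      by (auto simp: v1.dependent_def)
    have "f ` I - {f a} \<subseteq> f ` (I - {a})" by auto
    then have "f a \<in> v1.span (f ` (I - {a}))"
      using a v1.span_mono by blast
    \<comment> \<open>A dependence among the \<open>f i\<close> is pushed forward along
      \<open>C\<close>: a combination of the other vectors is related to some \<open>w\<close> in
      the span of the other \<open>h i\<close>. As \<open>C\<close> is single-valued,
      \<open>w\<close> is \<open>h a\<close>, which contradicts the independence of
      \<open>h\<close>.\<close>
    moreover have "v1.span (f ` (I - {a})) \<subseteq> {u. \<exists>w \<in> v2.span (h ` (I - {a})). (u, w) \<in> C}"
    proof (rule v1.span_minimal)
      show "f ` (I - {a}) \<subseteq> {u. \<exists>w \<in> v2.span (h ` (I - {a})). (u, w) \<in> C}"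
        using fh by (auto intro!: bexI[OF _ v2.span_base])
      show "v1.subspace {u. \<exists>w \<in> v2.span (h ` (I - {a})). (u, w) \<in> C}"
        by (rule subspace_preimage[OF assms(1,2) lin v2.subspace_span])
    qed
    ultimately obtain w where "w \<in> v2.span (h ` (I - {a}))" "(f a, w) \<in> C"
      by blast
    then have "h a \<in> v2.span (h ` (I - {a}))"
      using unique fh a by metis
    moreover have "h ` (I - {a}) = h ` I - {h a}"
      using inj a by (auto simp: inj_on_def)
    ultimately show False
      using ind a by (auto simp: v2.dependent_def)
  qed
  ultimately show ?thesis
    using \<open>I \<noteq> {}\<close> by (simp add: lin_indep_family_def)
qed

text \<open>The lift is inverted by a linear map \<open>g\<close> with \<open>g (h i) = f i\<close>.
  A vector \<open>u\<close> of the span is then recovered as \<open>g w\<close> from its image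
  \<open>w\<close> under \<open>C\<close>, so \<open>w = 0\<close> forces \<open>u = 0\<close>. If
  \<open>W\<close> is the null space, all \<open>h i\<close> vanish and the \<open>f i\<close> lie
  in the kernel of \<open>C\<close>, which is why \<open>f0\<close> asks that they be zero.\<close>

lemma span_lift_Int_ker:
  assumes "vector_space s1" and "vector_space s2"
    and C: "is_operator s1 s2 C"
    and h: "lin_indep_system s2 W I h"
    and fh: "\<And>i. i \<in> I \<Longrightarrow> (f i, h i) \<in> C"
    and f0: "W = {0} \<Longrightarrow> \<forall>i\<in>I. f i = 0"
  shows "module.span s1 (f ` I) \<inter> rel_ker C \<subseteq> {0}"
proof
  fix u assume u: "u \<in> module.span s1 (f ` I) \<inter> rel_ker C"
  interpret v1: vector_space s1 by fact
  interpret v2: vector_space s2 by fact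
  have lin: "linear_relation s1 s2 C"
    using C by (simp add: is_operator_def)
  note C' = lin[unfolded linear_relation_iff[OF assms(1,2)]]
  obtain g where g: "Vector_Spaces.linear s2 s1 g" "\<forall>i\<in>I. g (h i) = f i"
    using lin_indep_system_extend[OF assms(2,1) h f0] by blast
  interpret g: Vector_Spaces.linear s2 s1 g by (rule g)
  \<comment> \<open>The right-hand side is a subspace because both \<open>C\<close> and
    \<open>g\<close> are linear, so only the generators \<open>f i\<close>, with witness
    \<open>h i\<close>, matter.\<close>
  have "v1.span (f ` I) \<subseteq> {u. \<exists>w. (u, w) \<in> C \<and> g w = u}"
  proof (rule v1.span_minimal)
    show "f ` I \<subseteq> {u. \<exists>w. (u, w) \<in> C \<and> g w = u}"
      using fh g by blast
    show "v1.subspace {u. \<exists>w. (u, w) \<in> C \<and> g w = u}"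
    proof (rule v1.subspaceI; clarsimp)
      show "\<exists>w. (0, w) \<in> C \<and> g w = 0" using C' g.zero by blast
    next
      fix w w' assume "(g w, w) \<in> C" "(g w', w') \<in> C"
      then show "\<exists>w''. (g w + g w', w'') \<in> C \<and> g w'' = g w + g w'"
        using C' g.add by blast
    next
      fix c w assume "(g w, w) \<in> C"
      then show "\<exists>w'. (s1 c (g w), w') \<in> C \<and> g w' = s1 c (g w)"
        using C' g.scale by blast
    qed
  qed
  then obtain w where w: "(u, w) \<in> C" "g w = u"
    using u by blast
  moreover have "(u, 0) \<in> C"
    using u by (simp add: rel_ker_def)
  ultimately have "w = 0"
    using operator_unique[OF assms(1,2) C] by blast
  then show "u \<in> {0}" using w g.zero by simp
qed

lemma hamel_basis_mem:
  assumes "vector_space s" and "hamel_basis s W I f" and "i \<in> I"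
  shows "f i \<in> W"
proof -
  interpret vector_space s by fact
  show ?thesis
    using assms(2,3) span_base by (auto simp: hamel_basis_def)
qed

text \<open>The family \<open>y\<close> is chosen before the kernel basis \<open>x'\<close>: the
  trivial intersection holds because every \<open>y'\<close> is taken inside the kernel of
  \<open>C\<close>, whatever \<open>x'\<close> is.\<close>

lemma lift_bases_if_product:
  assumes "vector_space sX" and "vector_space sY" and "vector_space sZ"
    and A: "linear_relation sX sZ A" and B: "linear_relation sX sY B"
    and C: "is_operator sY sZ C" and ACB: "A \<subseteq> relation_product C B"
    and z: "hamel_basis sZ (Range A) I z"
  shows "\<exists>y. lin_indep_system sY (Range A) I y \<and>
    (\<forall>\<alpha>\<in>I. y \<alpha> \<in> relation_product B (A\<inverse>) `` {z \<alpha>}) \<and>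
    (\<forall>(J :: 'j set) x'. hamel_basis sX (rel_ker A) J x' \<longrightarrow>
       (\<exists>y'. (\<forall>\<beta>\<in>J. y' \<beta> \<in> B `` {x' \<beta>}) \<and>
          module.span sY (y ` I) \<inter> module.span sY (y' ` J) = {0}))"
proof -
  interpret vY: vector_space sY by fact
  interpret vZ: vector_space sZ by fact
  have linC: "linear_relation sY sZ C"
    using C by (simp add: is_operator_def)
  have z_sys: "lin_indep_system sZ (Range A) I z"
    using z by (simp add: hamel_basis_def)
  have lift: "\<exists>x y. (x, w) \<in> A \<and> (x, y) \<in> B \<and> (y, w) \<in> C" if "w \<in> Range A" for w
    using that ACB unfolding relation_product_def by blast
  obtain y where sys: "lin_indep_system sY (Range A) I y"
    and y: "\<And>\<alpha>. \<alpha> \<in> I \<Longrightarrow> y \<alpha> \<in> relation_product B (A\<inverse>) `` {z \<alpha>} \<and> (y \<alpha>, z \<alpha>) \<in> C"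
    and y0: "Range A = {0} \<Longrightarrow> \<forall>\<alpha>\<in>I. y \<alpha> = 0"
  proof (cases "Range A = {0}")
    case True
    then have "z \<alpha> = 0" if "\<alpha> \<in> I" for \<alpha>
      using hamel_basis_mem[OF assms(3) z] that by blast
    \<comment> \<open>No independent family contains \<open>0\<close>, so \<open>z\<close> must be
      the one-element zero system. Its index set is a singleton, and the constant \<open>0\<close>
      is an admissible lift over it.\<close>
    moreover have "zero_system I z"
    proof -
      have "\<not> lin_indep_family sZ I z"
        using calculation vZ.dependent_zero by (fastforce simp: lin_indep_family_def)
      then show ?thesis using z_sys by (simp add: lin_indep_system_def)
    qed
    moreover have "(0, 0) \<in> A" "(0, 0) \<in> B" "(0, 0) \<in> C"
      using A B linC linear_relation_iff assms(1-3) by metis+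
    ultimately show ?thesis
      using True by (intro that[of "\<lambda>_. 0"])
        (auto simp: lin_indep_system_def zero_system_def relation_product_def)
  next
    case False
    have "\<forall>\<alpha>\<in>I. \<exists>y. y \<in> relation_product B (A\<inverse>) `` {z \<alpha>} \<and> (y, z \<alpha>) \<in> C"
      using lift hamel_basis_mem[OF assms(3) z] unfolding relation_product_def by blast
    then obtain y where y: "\<And>\<alpha>. \<alpha> \<in> I \<Longrightarrow> y \<alpha> \<in> relation_product B (A\<inverse>) `` {z \<alpha>} \<and> (y \<alpha>, z \<alpha>) \<in> C"
      by metis
    have "lin_indep_family sZ I z"
      using z_sys False by (simp add: lin_indep_system_def)
    then have "lin_indep_family sY I y"
      using lin_indep_family_lift[OF assms(2,3) C] y by blast
    then show ?thesis
      using y False by (intro that[of y]) (auto simp: lin_indep_system_def)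
  qed
  have "\<exists>y'. (\<forall>\<beta>\<in>J. y' \<beta> \<in> B `` {x' \<beta>}) \<and>
          vY.span (y ` I) \<inter> vY.span (y' ` J) = {0}"
    if x': "hamel_basis sX (rel_ker A) J x'" for J :: "'j set" and x'
  proof -
    \<comment> \<open>Here \<open>(x' \<beta>, 0)\<close> lies in \<open>A\<close>, hence in the
      product; the intermediate vector is an image of \<open>x' \<beta>\<close> under
      \<open>B\<close> that \<open>C\<close> sends to \<open>0\<close>.\<close>
    have "\<forall>\<beta>\<in>J. \<exists>y'. y' \<in> B `` {x' \<beta>} \<and> y' \<in> rel_ker C"
      using hamel_basis_mem[OF assms(1) x'] ACB
      unfolding rel_ker_def relation_product_def by blast
    then obtain y' where y': "\<And>\<beta>. \<beta> \<in> J \<Longrightarrow> y' \<beta> \<in> B `` {x' \<beta>} \<and> y' \<beta> \<in> rel_ker C"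
      by metis
    have "vY.span (y' ` J) \<subseteq> rel_ker C"
      using y' subspace_rel_ker[OF assms(2,3) linC] by (intro vY.span_minimal) auto
    then have "vY.span (y ` I) \<inter> vY.span (y' ` J) \<subseteq> {0}"
      using span_lift_Int_ker[OF assms(2,3) C z_sys _ y0] y by blast
    then show ?thesis
      using y' vY.span_zero by blast
  qed
  then show ?thesis using sys y by blast
qed

section \<open>Constructing the operator from lifted bases\<close>

lemma product_if_lift_bases:
  assumes "vector_space sX" and "vector_space sY" and "vector_space sZ"
    and A: "linear_relation sX sZ A" and B: "linear_relation sX sY B"
    and z: "hamel_basis sZ (Range A) I z"
    and sys: "lin_indep_system sY (Range A) I y"
    and y: "\<forall>\<alpha>\<in>I. y \<alpha> \<in> relation_product B (A\<inverse>) `` {z \<alpha>}"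
    and x': "hamel_basis sX (rel_ker A) J x'"
    and y': "\<forall>\<beta>\<in>J. y' \<beta> \<in> B `` {x' \<beta>}"
    and Int: "module.span sY (y ` I) \<inter> module.span sY (y' ` J) = {0}"
  shows "\<exists>C. is_operator sY sZ C \<and> A \<subseteq> relation_product C B"
proof -
  interpret vX: vector_space sX by fact
  interpret vY: vector_space sY by fact
  interpret vZ: vector_space sZ by fact
  note A' = A[unfolded linear_relation_iff[OF assms(1,3)]]
  note B' = B[unfolded linear_relation_iff[OF assms(1,2)]]
  have "Range A = {0} \<Longrightarrow> \<forall>\<alpha>\<in>I. z \<alpha> = 0"
    using hamel_basis_mem[OF assms(3) z] by blast
  then obtain g where g: "Vector_Spaces.linear sY sZ g" "\<forall>\<alpha>\<in>I. g (y \<alpha>) = z \<alpha>"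
    using lin_indep_system_extend[OF assms(2,3) sys] by blast
  interpret g: Vector_Spaces.linear sY sZ g by (rule g)
  define U where "U = vY.span (y ` I)"
  define V where "V = vY.span (y' ` J)"
  have U: "vY.subspace U" and V: "vY.subspace V"
    by (simp_all add: U_def V_def)
  \<comment> \<open>The map \<open>g\<close> is defined on the whole space and may be nonzero on
    \<open>V\<close>. Using \<open>g u\<close> in place of \<open>g (u + v)\<close> makes
    \<open>C\<close> vanish on \<open>V\<close>; the trivial intersection of \<open>U\<close> and
    \<open>V\<close> makes the value independent of the decomposition.\<close>
  define C where "C = {(u + v, g u) | u v. u \<in> U \<and> v \<in> V}"
  have C_iff: "(p, w) \<in> C \<longleftrightarrow> (\<exists>u\<in>U. \<exists>v\<in>V. p = u + v \<and> w = g u)" for p w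
    unfolding C_def by blast
  have "linear_relation sY sZ C"
    unfolding linear_relation_iff[OF assms(2,3)]
  proof (intro conjI allI impI)
    show "(0, 0) \<in> C"
      unfolding C_iff using U V vY.subspace_0 g.zero by (metis add_0)
  next
    fix p w p' w'
    assume "(p, w) \<in> C" and "(p', w') \<in> C"
    then obtain u v u' v' where *: "u \<in> U" "v \<in> V" "u' \<in> U" "v' \<in> V"
      and eq: "p = u + v" "w = g u" "p' = u' + v'" "w' = g u'"
      unfolding C_iff by blast
    have "u + u' \<in> U" "v + v' \<in> V"
      using * U V vY.subspace_add by blast+
    moreover have "p + p' = (u + u') + (v + v')" "w + w' = g (u + u')"
      using eq g.add by (simp_all add: algebra_simps)
    ultimately show "(p + p', w + w') \<in> C"
      unfolding C_iff by blast
  next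
    fix c p w
    assume "(p, w) \<in> C"
    then show "(sY c p, sZ c w) \<in> C"
      unfolding C_iff using U V vY.subspace_scale vY.scale_right_distrib g.scale by metis
  qed
  moreover have "rel_mul C = {0}"
  proof -
    have "w = 0" if "(0, w) \<in> C" for w
    proof -
      obtain u v where uv: "u \<in> U" "v \<in> V" "0 = u + v" "w = g u"
        using \<open>(0, w) \<in> C\<close> unfolding C_iff by blast
      have "u = - v" using uv(3) by (simp add: eq_neg_iff_add_eq_0)
      then have "u \<in> U \<inter> V" using uv V vY.subspace_neg by blast
      then have "u = 0" using Int by (auto simp: U_def V_def)
      then show "w = 0" using uv g.zero by simp
    qed
    moreover have "(0, 0) \<in> C"
      using \<open>linear_relation sY sZ C\<close> by (simp add: linear_relation_iff assms)
    ultimately show ?thesis by (auto simp: rel_mul_def)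
  qed
  moreover have "A \<subseteq> relation_product C B"
  proof (rule subrelI)
    fix x w assume xw: "(x, w) \<in> A"
    \<comment> \<open>Every \<open>w\<close> in the range of \<open>A\<close> has at least one
      preimage \<open>x\<close> with an image \<open>u\<close> in \<open>U\<close> under
      \<open>B\<close> such that \<open>g u = w\<close>. Such \<open>w\<close> form a subspace, and
      each \<open>z \<alpha>\<close> belongs to it with \<open>u = y \<alpha>\<close>.\<close>
    have "Range A \<subseteq> {w. \<exists>x. \<exists>u\<in>U. (x, w) \<in> A \<and> (x, u) \<in> B \<and> g u = w}"
    proof -
      have "z ` I \<subseteq> {w. \<exists>x. \<exists>u\<in>U. (x, w) \<in> A \<and> (x, u) \<in> B \<and> g u = w}"
      proof (rule image_subsetI)
        fix \<alpha> assume "\<alpha> \<in> I"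
        moreover from this have "y \<alpha> \<in> U"
          by (simp add: U_def vY.span_base)
        ultimately show "z \<alpha> \<in> {w. \<exists>x. \<exists>u\<in>U. (x, w) \<in> A \<and> (x, u) \<in> B \<and> g u = w}"
          using y g(2) unfolding relation_product_def by blast
      qed
      moreover have "vZ.subspace {w. \<exists>x. \<exists>u\<in>U. (x, w) \<in> A \<and> (x, u) \<in> B \<and> g u = w}"
      proof (rule vZ.subspaceI; clarsimp)
        show "\<exists>x. (x, 0) \<in> A \<and> (\<exists>u\<in>U. (x, u) \<in> B \<and> g u = 0)"
          using A' B' U vY.subspace_0 g.zero by blast
      next
        fix x u x' u'
        assume "(x, g u) \<in> A" "u \<in> U" "(x, u) \<in> B" "(x', g u') \<in> A" "u' \<in> U" "(x', u') \<in> B"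
        then have "(x + x', g u + g u') \<in> A" "u + u' \<in> U" "(x + x', u + u') \<in> B"
          using A' B' U vY.subspace_add by blast+
        then show "\<exists>x''. (x'', g u + g u') \<in> A \<and> (\<exists>u''\<in>U. (x'', u'') \<in> B \<and> g u'' = g u + g u')"
          using g.add by blast
      next
        fix c x u assume "(x, g u) \<in> A" "u \<in> U" "(x, u) \<in> B"
        then have "(sX c x, sZ c (g u)) \<in> A" "sY c u \<in> U" "(sX c x, sY c u) \<in> B"
          using A' B' U vY.subspace_scale by blast+
        then show "\<exists>x'. (x', sZ c (g u)) \<in> A \<and> (\<exists>u'\<in>U. (x', u') \<in> B \<and> g u' = sZ c (g u))"
          using g.scale by blast
      qed
      ultimately have "vZ.span (z ` I) \<subseteq> {w. \<exists>x. \<exists>u\<in>U. (x, w) \<in> A \<and> (x, u) \<in> B \<and> g u = w}"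
        by (rule vZ.span_minimal)
      then show ?thesis using z by (simp add: hamel_basis_def)
    qed
    then obtain x0 u where u: "u \<in> U" "(x0, w) \<in> A" "(x0, u) \<in> B" "g u = w"
      using xw by blast
    \<comment> \<open>The given \<open>x\<close> and the good preimage \<open>x0\<close> of
      \<open>w\<close> differ by a kernel vector of \<open>A\<close>, which \<open>B\<close> relates
      to some \<open>v\<close> in \<open>V\<close>. Adding, \<open>B\<close> relates
      \<open>x\<close> to \<open>u + v\<close>, and \<open>C\<close> sends this to
      \<open>g u = w\<close>.\<close>
    have "(x - x0, w - w) \<in> A"
      using linear_relation_diff[OF assms(1,3) A xw u(2)] .
    then have "x - x0 \<in> rel_ker A" by (simp add: rel_ker_def)
    moreover have "rel_ker A \<subseteq> {x. \<exists>v\<in>V. (x, v) \<in> B}"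
    proof -
      have "x' ` J \<subseteq> {x. \<exists>v\<in>V. (x, v) \<in> B}"
        using y' vY.span_base unfolding V_def by blast
      moreover have "vX.subspace {x. \<exists>v\<in>V. (x, v) \<in> B}"
        by (rule subspace_preimage[OF assms(1,2) B V])
      ultimately have "vX.span (x' ` J) \<subseteq> {x. \<exists>v\<in>V. (x, v) \<in> B}"
        by (rule vX.span_minimal)
      then show ?thesis using x' by (simp add: hamel_basis_def)
    qed
    ultimately obtain v where v: "v \<in> V" "(x - x0, v) \<in> B" by blast
    have "(x0 + (x - x0), u + v) \<in> B"
      using B' u(3) v(2) by blast
    moreover have "(u + v, w) \<in> C"
      using u v unfolding C_iff by blast
    ultimately show "(x, w) \<in> relation_product C B"
      by (auto simp: relation_product_def)
  qed
  ultimately show ?thesis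
    unfolding is_operator_def by blast
qed

(* Index sets are taken inside the types 'z and 'x of the ambient spaces. This loses no
   generality: a Hamel basis is an injective family, so it can be indexed by its own vectors. *)

theorem theorem4p2:
  fixes sX :: "'k::real_normed_field \<Rightarrow> 'x::ab_group_add \<Rightarrow> 'x"
    and sY :: "'k \<Rightarrow> 'y::ab_group_add \<Rightarrow> 'y"
    and sZ :: "'k \<Rightarrow> 'z::ab_group_add \<Rightarrow> 'z"
    and A :: "('x \<times> 'z) set"
    and B :: "('x \<times> 'y) set"
  assumes "vector_space sX" and "vector_space sY" and "vector_space sZ"
    and "linear_relation sX sZ A" and "linear_relation sX sY B"
  defines "stmt_i \<equiv> (\<exists>C. is_operator sY sZ C \<and> A \<subseteq> relation_product C B)"
    and "stmt_ii \<equiv>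
      (\<exists>(I :: 'z set) z y (J :: 'x set) x' y'.
         hamel_basis sZ (Range A) I z \<and>
         lin_indep_system sY (Range A) I y \<and>
         (\<forall>\<alpha>\<in>I. y \<alpha> \<in> relation_product B (A\<inverse>) `` {z \<alpha>}) \<and>
         hamel_basis sX (rel_ker A) J x' \<and>
         (\<forall>\<beta>\<in>J. y' \<beta> \<in> B `` {x' \<beta>}) \<and>
         module.span sY (y ` I) \<inter> module.span sY (y' ` J) = {0})"
    and "stmt_iii \<equiv>
      (\<forall>(I :: 'z set) z. hamel_basis sZ (Range A) I z \<longrightarrow>
         (\<exists>y. lin_indep_system sY (Range A) I y \<and>
            (\<forall>\<alpha>\<in>I. y \<alpha> \<in> relation_product B (A\<inverse>) `` {z \<alpha>}) \<and>
            (\<forall>(J :: 'x set) x'. hamel_basis sX (rel_ker A) J x' \<longrightarrow>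
               (\<exists>y'. (\<forall>\<beta>\<in>J. y' \<beta> \<in> B `` {x' \<beta>}) \<and>
                  module.span sY (y ` I) \<inter> module.span sY (y' ` J) = {0}))))"
  shows "(stmt_i \<longleftrightarrow> stmt_ii) \<and> (stmt_ii \<longleftrightarrow> stmt_iii)"
proof -
  have i_iii: stmt_iii if stmt_i
  proof -
    obtain C where C: "is_operator sY sZ C" "A \<subseteq> relation_product C B"
      using \<open>stmt_i\<close> unfolding stmt_i_def by blast
    show ?thesis
      unfolding stmt_iii_def by (intro allI impI lift_bases_if_product[OF assms(1-5) C])
  qed
  have iii_ii: "stmt_ii" if stmt_iii
  proof -
    obtain I :: "'z set" and z where z: "hamel_basis sZ (Range A) I z"
      using hamel_basis_exists[OF assms(3) subspace_Range[OF assms(1,3,4)]] by blast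
    obtain J :: "'x set" and x' where x': "hamel_basis sX (rel_ker A) J x'"
      using hamel_basis_exists[OF assms(1) subspace_rel_ker[OF assms(1,3,4)]] by blast
    \<comment> \<open>Since \<open>y\<close> is fixed before the kernel basis in
      \<open>stmt_iii\<close>, the remaining claim \<open>ker\<close> can be specialised to the
      basis \<open>x'\<close> already chosen.\<close>
    obtain y where y: "lin_indep_system sY (Range A) I y"
        "\<forall>\<alpha>\<in>I. y \<alpha> \<in> relation_product B (A\<inverse>) `` {z \<alpha>}"
      and ker: "\<forall>(J :: 'x set) x'. hamel_basis sX (rel_ker A) J x' \<longrightarrow>
        (\<exists>y'. (\<forall>\<beta>\<in>J. y' \<beta> \<in> B `` {x' \<beta>}) \<and>
          module.span sY (y ` I) \<inter> module.span sY (y' ` J) = {0})"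
      using \<open>stmt_iii\<close>[unfolded stmt_iii_def, THEN spec, THEN spec, THEN mp, OF z]
      by (elim exE conjE)
    obtain y' where "\<forall>\<beta>\<in>J. y' \<beta> \<in> B `` {x' \<beta>}"
        "module.span sY (y ` I) \<inter> module.span sY (y' ` J) = {0}"
      using ker[THEN spec, THEN spec, THEN mp, OF x'] by (elim exE conjE)
    with z y x' show ?thesis
      unfolding stmt_ii_def by (intro exI conjI)
  qed
  have ii_i: "stmt_i" if stmt_ii
    using that unfolding stmt_i_def stmt_ii_def
    by (elim exE conjE) (rule product_if_lift_bases[OF assms(1-5)])
  show ?thesis using i_iii iii_ii ii_i by blast
qed

end
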